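(* Let $\ell\ge1$, $g\ge0$ with $\ell-2g\ge1$, let $E$ be a fixed $\ell$-dimensional vector space, and let $X_1,\dots,X_N\subset\mathbb{A}^{\ell^2}$, $N=\binom{\ell-2g+1}{2}$, be the hyperplanes with equations $$x_{ij}=0\ (1\le i<j\le\ell-2g),\qquad x_{i1}+\cdots+x_{i,\ell-2g}=0\ (1\le i\le\ell-2g).$$ Every $I\subseteq\{1,\dots,N\}$ determines a choice of linear subspaces $V_1,\dots,V_\ell$ of $E$ such that $$\bigcap_{k\in I}X_k=\{(v_1,\dots,v_\ell)\in\mathbb{A}^{\ell^2}\mid \forall i,\ v_i\in V_i\}.$$ Further, $\dim V_i\ge i-1$. Further still, there exists a basis $(e_1,\dots,e_\ell)$ of $E$ such that each space $V_i$ is the span of a subset (of cardinality $\ge i-1$) of the vectors $e_j$.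
   Context: $\mathbb{A}^{\ell^2}$ is the space of $\ell\times\ell$ matrices $x=(x_{ij})$; such a matrix is denoted by its $\ell$ row vectors $v_1,\dots,v_\ell\in E$, where $E$ is identified with the coordinate space with coordinates $x_1,\dots,x_\ell$ (so $v_i$ has coordinates $x_{i1},\dots,x_{i\ell}$). For $I=\emptyset$ the intersection is $\mathbb{A}^{\ell^2}$. *)

theory Defs
  imports "Jordan_Normal_Form.VS_Connect"
begin

text \<open>
  The affine space of \<open>\<ell> \<times> \<ell>\<close> matrices over an arbitrary field is \<open>carrier_mat l l\<close>, and
  \<open>E\<close> is the coordinate space \<open>carrier_vec l\<close>, as the vector space \<open>module_vec TYPE('k) l\<close>.
  Indices are 1-based here, as opposed to the 0-based \<open>$$\<close> and \<open>row\<close> of the matrix library.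
\<close>

definition entry :: "'k mat \<Rightarrow> nat \<Rightarrow> nat \<Rightarrow> 'k" where
  "entry A i j = A $$ (i - 1, j - 1)"

definition row_vector :: "'k mat \<Rightarrow> nat \<Rightarrow> 'k vec" where
  "row_vector A i = row A (i - 1)"

definition entry_hyperplane :: "nat \<Rightarrow> nat \<Rightarrow> nat \<Rightarrow> 'k::field mat set" where
  "entry_hyperplane l i j = {A \<in> carrier_mat l l. entry A i j = 0}"

definition row_sum_hyperplane :: "nat \<Rightarrow> nat \<Rightarrow> nat \<Rightarrow> 'k::field mat set" where
  "row_sum_hyperplane l g i = {A \<in> carrier_mat l l. (\<Sum>j = 1..l - 2 * g. entry A i j) = 0}"

definition hyperplanes :: "nat \<Rightarrow> nat \<Rightarrow> 'k::field mat set set" where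
  "hyperplanes l g =
     {entry_hyperplane l i j | i j. 1 \<le> i \<and> i < j \<and> j \<le> l - 2 * g} \<union>
     {row_sum_hyperplane l g i | i. 1 \<le> i \<and> i \<le> l - 2 * g}"

text \<open>
  For empty \<open>I\<close> this is the whole matrix space, because of the explicit intersection with
  \<open>carrier_mat l l\<close> (the library's empty intersection would be \<open>UNIV\<close>).
\<close>

definition hyperplane_inter :: "nat \<Rightarrow> (nat \<Rightarrow> 'k::field mat set) \<Rightarrow> nat set \<Rightarrow> 'k mat set" where
  "hyperplane_inter l X I = carrier_mat l l \<inter> (\<Inter>k\<in>I. X k)"

definition rows_in :: "nat \<Rightarrow> (nat \<Rightarrow> 'k::field vec set) \<Rightarrow> 'k mat set" where
  "rows_in l V = {A \<in> carrier_mat l l. \<forall>i\<in>{1..l}. row_vector A i \<in> V i}"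

definition linear_subspace :: "nat \<Rightarrow> 'k::field vec set \<Rightarrow> bool" where
  "linear_subspace l W \<longleftrightarrow> subspace class_ring W (module_vec TYPE('k) l)"

definition subspace_dim :: "nat \<Rightarrow> 'k::field vec set \<Rightarrow> nat" where
  "subspace_dim l W = vectorspace.dim class_ring (vectorspace.vs (module_vec TYPE('k) l) W)"

definition is_basis :: "nat \<Rightarrow> (nat \<Rightarrow> 'k::field vec) \<Rightarrow> bool" where
  "is_basis l e \<longleftrightarrow>
     inj_on e {1..l} \<and> vectorspace.basis class_ring (module_vec TYPE('k) l) (e ` {1..l})"

definition linear_span :: "nat \<Rightarrow> 'k::field vec set \<Rightarrow> 'k vec set" where
  "linear_span l S = LinearCombinations.module.span class_ring (module_vec TYPE('k) l) S"

definition subspaces_cut_out ::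
  "nat \<Rightarrow> (nat \<Rightarrow> 'k::field mat set) \<Rightarrow> nat set \<Rightarrow> (nat \<Rightarrow> 'k vec set) \<Rightarrow> bool" where
  "subspaces_cut_out l X I V \<longleftrightarrow>
     (\<forall>i\<in>{1..l}. linear_subspace l (V i)) \<and> hyperplane_inter l X I = rows_in l V"

text \<open>
  The listed hyperplanes are pairwise distinct, so that they can be enumerated without
  repetition by \<open>{1..N}\<close> for the stated value of \<open>N\<close>.
\<close>

lemma card_hyperplanes:
  "card (hyperplanes l g :: 'k::field mat set set) = (l - 2 * g + 1) choose 2"
proof -
  define m where "m = l - 2 * g"
  have ml: "m \<le> l" by (simp add: m_def)
  define U where "U p q = (mat l l (\<lambda>(a, b). if a = p - 1 \<and> b = q - 1 then 1 else 0) :: 'k mat)"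
    for p q :: nat
  have U_car: "U p q \<in> carrier_mat l l" for p q by (simp add: U_def)
  have U_entry: "entry (U p q) i j = (if i = p \<and> j = q then 1 else 0)"
    if "i \<in> {1..m}" "j \<in> {1..m}" "p \<in> {1..m}" "q \<in> {1..m}" for i j p q
    using that ml by (auto simp: entry_def U_def)
  have U_eh: "U p q \<in> entry_hyperplane l i j \<longleftrightarrow> \<not> (i = p \<and> j = q)"
    if "i \<in> {1..m}" "j \<in> {1..m}" "p \<in> {1..m}" "q \<in> {1..m}" for i j p q
    using U_entry[OF that] U_car by (simp add: entry_hyperplane_def)
  have U_rh: "U p q \<in> row_sum_hyperplane l g i \<longleftrightarrow> i \<noteq> p"
    if "i \<in> {1..m}" "p \<in> {1..m}" "q \<in> {1..m}" for i p q
  proof -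
    have "(\<Sum>j = 1..m. entry (U p q) i j) = (\<Sum>j = 1..m. if i = p \<and> j = q then 1 else 0)"
      by (rule sum.cong) (use U_entry that in auto)
    also have "\<dots> = (if i = p then 1 else 0)" using that by auto
    finally show ?thesis using U_car by (simp add: row_sum_hyperplane_def flip: m_def)
  qed
  define F where "F = (\<lambda>(i, j). if i = j then row_sum_hyperplane l g i
    else entry_hyperplane l i j :: 'k mat set)"
  define P where "P = (SIGMA i:{1..m}. {i..m})"
  have img: "hyperplanes l g = F ` P"
  proof (intro equalityI subsetI)
    fix H :: "'k mat set" assume "H \<in> hyperplanes l g"
    then consider i j where "H = entry_hyperplane l i j" "1 \<le> i" "i < j" "j \<le> m"
      | i where "H = row_sum_hyperplane l g i" "1 \<le> i" "i \<le> m"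
      by (auto simp: hyperplanes_def m_def)
    then show "H \<in> F ` P"
    proof cases
      case 1
      then show ?thesis by (intro image_eqI[of _ _ "(i, j)"]) (auto simp: F_def P_def)
    next
      case 2
      then show ?thesis by (intro image_eqI[of _ _ "(i, i)"]) (auto simp: F_def P_def)
    qed
  next
    fix H :: "'k mat set" assume "H \<in> F ` P"
    then obtain i j where ij: "H = F (i, j)" "1 \<le> i" "i \<le> j" "j \<le> m" by (auto simp: P_def)
    show "H \<in> hyperplanes l g"
    proof (cases "i = j")
      case True
      then show ?thesis using ij by (auto simp: F_def hyperplanes_def m_def)
    next
      case False
      with ij have "H = entry_hyperplane l i j" "i < j" by (auto simp: F_def)
      then show ?thesis using ij unfolding hyperplanes_def m_def by blast
    qed
  qed
  have char: "U p q \<in> F (i, j) \<longleftrightarrow> \<not> (i = p \<and> (j = q \<or> i = j))"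
    if "(i, j) \<in> P" "p \<in> {1..m}" "q \<in> {1..m}" for i j p q
  proof (cases "i = j")
    case True
    then show ?thesis using that U_rh[of i p q] by (auto simp: F_def P_def)
  next
    case False
    then show ?thesis using that U_eh[of i j p q] by (auto simp: F_def P_def)
  qed
  have "inj_on F P"
  proof (intro inj_onI, clarify)
    fix i j i' j' assume P: "(i, j) \<in> P" "(i', j') \<in> P" and eq: "F (i, j) = F (i', j')"
    have rng: "i \<in> {1..m}" "j \<in> {1..m}" "i' \<in> {1..m}" "j' \<in> {1..m}" "i \<le> j" "i' \<le> j'"
      using P by (auto simp: P_def)
    note c = char[OF P(1)] char[OF P(2)]
    have c: "(i = p \<and> (j = q \<or> i = j)) \<longleftrightarrow> (i' = p \<and> (j' = q \<or> i' = j'))"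
      if "p \<in> {1..m}" "q \<in> {1..m}" for p q
      using char[OF P(1) that] char[OF P(2) that] eq by blast
    have ii: "i = i'" using c[OF rng(1,2)] by blast
    have "j = j'" if "i = j" using c[OF rng(1,1)] ii that by metis
    moreover have "j = j'" if "i \<noteq> j"
      using c[OF rng(1,2)] c[OF rng(1,1)] ii that by metis
    ultimately show "i = i' \<and> j = j'" using ii by blast
  qed
  then have "card (hyperplanes l g :: 'k mat set set) = card P"
    unfolding img by (rule card_image)
  also have "\<dots> = (\<Sum>i = 1..m. Suc m - i)" by (simp add: P_def)
  also have "\<dots> = (m + 1) choose 2"
  proof -
    have "(\<Sum>i = 1..m. Suc m - i) = (\<Sum>i = 1..m. i)"
      by (rule sum.reindex_bij_witness[of _ "\<lambda>i. Suc m - i" "\<lambda>i. Suc m - i"]) auto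
    also have "\<dots> = (m + 1) choose 2"
      using gauss_sum_from_Suc_0[of m, where ?'a = nat] by (simp add: choose_two)
    finally show ?thesis .
  qed
  finally show ?thesis by (simp add: m_def)
qed

end

theory Submission
  imports Defs "Jordan_Normal_Form.DL_Rank"
begin

text \<open>
  Put \<open>m = l - 2 * g\<close>.  Every hyperplane of the family constrains a single row: it says that row
  \<open>i\<close> is killed by a linear form on \<open>E\<close>, either by \<open>x\<^sub>j\<close> with \<open>i < j \<le> m\<close> or by the sum
  \<open>s = x\<^sub>1 + \<dots> + x\<^sub>m\<close>.  So an intersection of hyperplanes imposes independent conditions on the
  rows, and \<open>V\<^sub>i\<close> is the common kernel of the forms imposed on row \<open>i\<close>.

  The decisive point is that the entries \<open>x\<^sub>i\<^sub>j\<close> with \<open>i < j\<close> avoid the first column, so that all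
  the forms in play, for all rows and all \<open>I\<close>, belong to the one basis \<open>s, x\<^sub>2, \<dots>, x\<^sub>l\<close> of the dual
  space of \<open>E\<close>; this is a basis because \<open>s\<close> is \<open>x\<^sub>1\<close> up to a combination of \<open>x\<^sub>2, \<dots>, x\<^sub>m\<close>.  In
  the basis \<open>e\<close> of \<open>E\<close> dual to it, the common kernel of some of these forms is spanned by the
  vectors \<open>e\<^sub>j\<close> whose own form is not among them (lemma \<open>common_kernel_eq_span\<close>).  The basis is
  explicit: \<open>e\<^sub>1\<close> is the first unit vector \<open>u\<^sub>1\<close>, \<open>e\<^sub>j = u\<^sub>j - u\<^sub>1\<close> for \<open>1 < j \<le> m\<close>, and
  \<open>e\<^sub>j = u\<^sub>j\<close> for \<open>j > m\<close>; in particular it does not even depend on \<open>I\<close>.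

  At most \<open>1 + (m - i)\<close> of the forms can be imposed on a row \<open>i \<le> m\<close>, and none on a later row; this
  is at most \<open>l - (i - 1)\<close>; hence at least \<open>i - 1\<close> basis vectors remain.  Finally, the subspaces are
  determined by the product set they cut out, because a product of sets containing zero determines
  each factor (lemma \<open>rows_in_determines_subspaces\<close>).
\<close>

section \<open>Common kernels of members of a dual basis\<close>

locale dual_bases =
  fixes l :: nat and e :: "nat \<Rightarrow> 'k::field vec" and \<phi> :: "nat \<Rightarrow> 'k vec \<Rightarrow> 'k"
  assumes basis_vector_carrier: "j \<in> {1..l} \<Longrightarrow> e j \<in> carrier_vec l"
    and form_add: "\<lbrakk>j \<in> {1..l}; v \<in> carrier_vec l; w \<in> carrier_vec l\<rbrakk> \<Longrightarrow> \<phi> j (v + w) = \<phi> j v + \<phi> j w"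
    and form_smult: "\<lbrakk>j \<in> {1..l}; v \<in> carrier_vec l\<rbrakk> \<Longrightarrow> \<phi> j (c \<cdot>\<^sub>v v) = c * \<phi> j v"
    and form_basis_vector:
      "\<lbrakk>j \<in> {1..l}; k \<in> {1..l}\<rbrakk> \<Longrightarrow> \<phi> j (e k) = (if j = k then 1 else 0)"
    and expansion: "\<lbrakk>v \<in> carrier_vec l; a < l\<rbrakk> \<Longrightarrow> v $ a = (\<Sum>j = 1..l. \<phi> j v * e j $ a)"
begin

sublocale vec_space "TYPE('k)" l .

definition common_kernel :: "nat set \<Rightarrow> 'k vec set" where
  "common_kernel K = {v \<in> carrier_vec l. \<forall>j\<in>K. \<phi> j v = 0}"

lemma inj_on_basis_vectors: "inj_on e {1..l}"
proof (rule inj_onI)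
  fix j k assume jk: "j \<in> {1..l}" "k \<in> {1..l}" and eq: "e j = e k"
  have "\<phi> j (e k) = 1" using form_basis_vector[OF jk(1) jk(1)] eq by simp
  then show "j = k" using form_basis_vector[OF jk] by (auto split: if_splits)
qed

lemma basis_vectors_carrier: "J \<subseteq> {1..l} \<Longrightarrow> e ` J \<subseteq> carrier_vec l"
  using basis_vector_carrier by auto

lemma form_zero: "j \<in> {1..l} \<Longrightarrow> \<phi> j (0\<^sub>v l) = 0"
  using form_smult[of j "0\<^sub>v l" 0] by simp

lemma common_kernel_submodule:
  assumes "K \<subseteq> {1..l}"
  shows "submodule class_ring (common_kernel K) V"
proof (unfold_locales, goal_cases)
  case 1 then show ?case by (auto simp: common_kernel_def)
next
  case (2 v w) then show ?case using assms form_add by (auto simp: common_kernel_def)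
next
  case 3 then show ?case using assms form_zero by (auto simp: common_kernel_def)
next
  case (4 c v) then show ?case using assms form_smult by (auto simp: common_kernel_def)
qed

text \<open>
  By the expansion \<open>v = (\<Sum>j. \<phi> j v \<cdot> e j)\<close>, killing the forms with index in \<open>K\<close> means exactly
  that the vectors \<open>e j\<close> with \<open>j \<in> K\<close> are missing from the expansion.
\<close>

lemma common_kernel_eq_span:
  assumes K: "K \<subseteq> {1..l}"
  shows "common_kernel K = span (e ` ({1..l} - K))"
proof
  let ?J = "{1..l} - K"
  have car: "e ` ?J \<subseteq> carrier_vec l" by (rule basis_vectors_carrier) auto
  have inj: "inj_on e ?J" using inj_on_basis_vectors by (rule inj_on_subset) auto
  show "common_kernel K \<subseteq> span (e ` ?J)"
  proof
    fix v assume v: "v \<in> common_kernel K"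
    then have vc: "v \<in> carrier_vec l" by (simp add: common_kernel_def)
    define c where "c u = \<phi> (the_inv_into ?J e u) v" for u
    have "v = lincomb c (e ` ?J)"
    proof (rule eq_vecI)
      have fin: "finite (e ` ?J)" by simp
      show "dim_vec v = dim_vec (lincomb c (e ` ?J))"
        using vc lincomb_dim[OF fin car] by simp
    next
      fix a assume "a < dim_vec (lincomb c (e ` ?J))"
      then have a: "a < l" using lincomb_dim[OF _ car] by simp
      have "lincomb c (e ` ?J) $ a = (\<Sum>u\<in>e ` ?J. c u * u $ a)"
        by (rule lincomb_index[OF a car])
      also have "\<dots> = (\<Sum>j\<in>?J. c (e j) * e j $ a)"
        by (simp only: sum.reindex[OF inj] o_def)
      also have "\<dots> = (\<Sum>j\<in>?J. \<phi> j v * e j $ a)"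
        by (rule sum.cong) (simp_all only: c_def the_inv_into_f_f[OF inj])
      also have "\<dots> = (\<Sum>j = 1..l. \<phi> j v * e j $ a)"
        by (rule sum.mono_neutral_left) (use v in \<open>auto simp: common_kernel_def\<close>)
      also have "\<dots> = v $ a" using expansion[OF vc a] by simp
      finally show "v $ a = lincomb c (e ` ?J) $ a" by simp
    qed
    then show "v \<in> span (e ` ?J)" by (rule in_spanI) auto
  qed
  have "e ` ?J \<subseteq> common_kernel K"
    using K basis_vector_carrier form_basis_vector by (auto simp: common_kernel_def)
  then show "span (e ` ?J) \<subseteq> common_kernel K"
    using common_kernel_submodule[OF K] by (rule span_is_subset)
qed

lemma basis_vectors_basis: "basis (e ` {1..l})"
proof (rule dim_gen_is_basis)
  show "span (e ` {1..l}) = carrier_vec l"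
    using common_kernel_eq_span[of "{}"] by (simp add: common_kernel_def)
  show "card (e ` {1..l}) \<le> dim"
    using card_image_le[of "{1..l}" e] by (simp add: dim_is_n)
qed (use basis_vectors_carrier in auto)

lemma dim_common_kernel:
  assumes K: "K \<subseteq> {1..l}"
  shows "vectorspace.dim class_ring (vs (common_kernel K)) = l - card K"
proof -
  let ?S = "e ` ({1..l} - K)"
  have "lin_indpt (e ` {1..l})" using basis_vectors_basis by (simp add: basis_def)
  then have "lin_indpt ?S" by (rule subset_li_is_li) auto
  then have "maximal ?S (\<lambda>T. T \<subseteq> ?S \<and> lin_indpt T)" by (auto simp: maximal_def)
  then have "vectorspace.dim class_ring (span_vs ?S) = card ?S"
    by (intro dim_span basis_vectors_carrier) auto
  moreover have "card ?S = l - card K"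
    using K by (subst card_image[OF inj_on_subset[OF inj_on_basis_vectors]])
      (auto simp: card_Diff_subset finite_subset)
  ultimately show ?thesis by (simp add: common_kernel_eq_span[OF K])
qed

lemma common_kernel_subspace:
  assumes "K \<subseteq> {1..l}"
  shows "linear_subspace l (common_kernel K)"
  unfolding linear_subspace_def subspace_def
  using common_kernel_submodule[OF assms] vec_vs by (simp add: class_field_def)

end

section \<open>A basis adapted to all the hyperplanes\<close>

definition adapted_form :: "nat \<Rightarrow> nat \<Rightarrow> 'k::field vec \<Rightarrow> 'k" where
  "adapted_form m j v = (if j = 1 then \<Sum>k = 1..m. v $ (k - 1) else v $ (j - 1))"

definition adapted_basis :: "nat \<Rightarrow> nat \<Rightarrow> nat \<Rightarrow> 'k::field vec" where
  "adapted_basis l m j =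
     vec l (\<lambda>a. if a = j - 1 then 1 else if a = 0 \<and> j \<le> m then - 1 else 0)"

text \<open>
  The unit triangular substitution that replaces \<open>x\<^sub>1\<close> by \<open>x\<^sub>1 + \<dots> + x\<^sub>m\<close> is invertible as soon
  as \<open>x\<^sub>1\<close> occurs in the sum, that is, for \<open>m \<ge> 1\<close>.
\<close>

lemma dual_bases_adapted:
  assumes m: "1 \<le> m" "m \<le> l"
  shows "dual_bases l (adapted_basis l m) (adapted_form m :: nat \<Rightarrow> 'k::field vec \<Rightarrow> 'k)"
proof
  fix j assume "j \<in> {1..l}"
  show "adapted_basis l m j \<in> (carrier_vec l :: 'k vec set)" by (simp add: adapted_basis_def)
next
  fix j and v w :: "'k vec"
  assume vw: "j \<in> {1..l}" "v \<in> carrier_vec l" "w \<in> carrier_vec l"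
  have "(\<Sum>k = 1..m. (v + w) $ (k - 1)) = (\<Sum>k = 1..m. v $ (k - 1) + w $ (k - 1))"
    by (rule sum.cong) (use vw m in auto)
  then show "adapted_form m j (v + w) = adapted_form m j v + adapted_form m j w"
    using vw by (auto simp: adapted_form_def sum.distrib)
next
  fix j c and v :: "'k vec"
  assume "j \<in> {1..l}" "v \<in> carrier_vec l"
  then show "adapted_form m j (c \<cdot>\<^sub>v v) = c * adapted_form m j v"
    using m by (auto simp: adapted_form_def sum_distrib_left intro!: sum.cong)
next
  fix j k assume jk: "j \<in> {1..l}" "k \<in> {1..l}"
  show "adapted_form m j (adapted_basis l m k :: 'k vec) = (if j = k then 1 else 0)"
  proof (cases "j = 1")
    case True
    let ?b = "adapted_basis l m k :: 'k vec"
    have "(\<Sum>i = 1..m. ?b $ (i - 1)) = ?b $ 0 + (\<Sum>i = 2..m. ?b $ (i - 1))"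
      using m by (simp add: sum.atLeast_Suc_atMost numeral_2_eq_2)
    also have "(\<Sum>i = 2..m. ?b $ (i - 1)) = (\<Sum>i = 2..m. if i = k then 1 else 0)"
      by (rule sum.cong) (use m jk in \<open>auto simp: adapted_basis_def\<close>)
    also have "\<dots> = (if 2 \<le> k \<and> k \<le> m then 1 else 0)" by auto
    also have "?b $ 0 + \<dots> = (if 1 = k then 1 else 0)"
      using jk m by (auto simp: adapted_basis_def)
    finally show ?thesis using True by (simp add: adapted_form_def)
  next
    case False
    then show ?thesis using jk by (auto simp: adapted_form_def adapted_basis_def)
  qed
next
  fix v :: "'k vec" and a assume v: "v \<in> carrier_vec l" and a: "a < l"
  let ?f = "\<lambda>j. adapted_form m j v * adapted_basis l m j $ a"
  show "v $ a = (\<Sum>j = 1..l. ?f j)"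
  proof (cases "a = 0")
    case False
    have "(\<Sum>j = 1..l. ?f j) = (\<Sum>j = 1..l. if j = Suc a then v $ a else 0)"
      by (rule sum.cong) (use False a in \<open>auto simp: adapted_form_def adapted_basis_def\<close>)
    then show ?thesis using a by simp
  next
    case True
    \<comment> \<open>Here \<open>x\<^sub>1\<close> is recovered as \<open>s - x\<^sub>2 - \<dots> - x\<^sub>m\<close>.\<close>
    have "(\<Sum>j = 1..l. ?f j) = ?f 1 + (\<Sum>j = 2..l. ?f j)"
      using m by (simp add: sum.atLeast_Suc_atMost numeral_2_eq_2)
    also have "(\<Sum>j = 2..l. ?f j) = (\<Sum>j = 2..m. ?f j)"
      by (rule sum.mono_neutral_right) (use m True in \<open>auto simp: adapted_basis_def\<close>)
    also have "\<dots> = - (\<Sum>j = 2..m. v $ (j - 1))"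
      unfolding sum_negf[symmetric]
      by (rule sum.cong) (use m True in \<open>auto simp: adapted_form_def adapted_basis_def\<close>)
    also have "?f 1 = v $ 0 + (\<Sum>j = 2..m. v $ (j - 1))"
      using m True a
      by (simp add: adapted_form_def adapted_basis_def sum.atLeast_Suc_atMost numeral_2_eq_2)
    finally show ?thesis using True by simp
  qed
qed

section \<open>Intersections of the hyperplanes\<close>

definition form_hyperplane :: "nat \<Rightarrow> nat \<Rightarrow> nat \<Rightarrow> nat \<Rightarrow> 'k::field mat set" where
  "form_hyperplane l m i j = {A \<in> carrier_mat l l. adapted_form m j (row_vector A i) = 0}"

lemma entry_eq_row_vector:
  assumes "A \<in> carrier_mat l l" "i \<in> {1..l}" "j \<in> {1..l}"
  shows "entry A i j = row_vector A i $ (j - 1)"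
  using assms by (auto simp: entry_def row_vector_def)

lemma hyperplanes_eq_form_hyperplanes:
  "(hyperplanes l g :: 'k::field mat set set) =
     {form_hyperplane l (l - 2 * g) i j | i j. i \<in> {1..l - 2 * g} \<and> j \<in> insert 1 {i<..l - 2 * g}}"
  (is "?L = ?R")
proof -
  let ?m = "l - 2 * g"
  have e: "entry_hyperplane l i j = (form_hyperplane l ?m i j :: 'k mat set)"
    if "i \<in> {1..?m}" "j \<in> {i<..?m}" for i j
    using that by (auto simp: entry_hyperplane_def form_hyperplane_def adapted_form_def
        entry_eq_row_vector[of _ l])
  have s: "row_sum_hyperplane l g i = (form_hyperplane l ?m i 1 :: 'k mat set)" if i: "i \<in> {1..?m}" for i
  proof -
    have "(\<Sum>j = 1..?m. entry A i j) = (\<Sum>j = 1..?m. row_vector A i $ (j - 1))"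
      if "A \<in> carrier_mat l l" for A :: "'k mat"
      by (rule sum.cong) (use that i in \<open>auto simp: entry_eq_row_vector[of _ l]\<close>)
    then show ?thesis
      by (auto simp: row_sum_hyperplane_def form_hyperplane_def adapted_form_def simp del: One_nat_def)
  qed
  show ?thesis
  proof (intro equalityI subsetI)
    fix H :: "'k mat set" assume "H \<in> ?L"
    then consider i j where "H = entry_hyperplane l i j" "1 \<le> i" "i < j" "j \<le> ?m"
      | i where "H = row_sum_hyperplane l g i" "1 \<le> i" "i \<le> ?m"
      by (auto simp: hyperplanes_def)
    then show "H \<in> ?R"
    proof cases
      case (1 i j)
      then have "H = form_hyperplane l ?m i j" "i \<in> {1..?m}" "j \<in> insert 1 {i<..?m}"
        using e by auto
      then show ?thesis by blast
    next
      case (2 i)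
      then have "H = form_hyperplane l ?m i 1" "i \<in> {1..?m}" using s by auto
      then show ?thesis by blast
    qed
  next
    fix H :: "'k mat set" assume "H \<in> ?R"
    then obtain i j where ij: "H = form_hyperplane l ?m i j" "i \<in> {1..?m}" "j \<in> insert 1 {i<..?m}"
      by auto
    show "H \<in> ?L"
    proof (cases "j = 1")
      case True
      then have "H = row_sum_hyperplane l g i" using ij s by auto
      then show ?thesis using ij unfolding hyperplanes_def by auto
    next
      case False
      then have "H = entry_hyperplane l i j" "i < j" using ij e by auto
      then show ?thesis using ij False unfolding hyperplanes_def by auto
    qed
  qed
qed

definition imposed_forms :: "nat \<Rightarrow> nat \<Rightarrow> 'k::field mat set set \<Rightarrow> nat \<Rightarrow> nat set" where
  "imposed_forms l m \<H> i =
     {j. i \<in> {1..m} \<and> j \<in> insert 1 {i<..m} \<and> form_hyperplane l m i j \<in> \<H>}"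

lemma imposed_forms_subset:
  assumes "m \<le> l"
  shows "imposed_forms l m \<H> i \<subseteq> {1..l}"
  using assms by (auto simp: imposed_forms_def)

text \<open>
  Row \<open>i\<close> can be subject to the sum and to the \<open>m - i\<close> coordinates to the right of the diagonal
  within the first \<open>m\<close> columns, so \<open>Suc (m - i)\<close> forms in all; rows below the first \<open>m\<close> are free.
\<close>

lemma card_imposed_forms:
  assumes "m \<le> l" "i \<in> {1..l}"
  shows "card (imposed_forms l m \<H> i) \<le> l - (i - 1)"
proof (cases "i \<le> m")
  case True
  have "card (imposed_forms l m \<H> i) \<le> card (insert 1 {i<..m})"
    by (rule card_mono) (auto simp: imposed_forms_def)
  also have "\<dots> \<le> Suc (m - i)" using card_insert_le_m1[of "Suc (m - i)" "{i<..m}" 1] by simp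
  also have "\<dots> \<le> l - (i - 1)" using assms True by auto
  finally show ?thesis .
qed (simp add: imposed_forms_def)

text \<open>
  A vector of \<open>V i\<close>, placed in row \<open>i\<close> of an otherwise zero matrix, tests membership in \<open>W i\<close>:
  the zero rows lie in the other \<open>V k\<close>, which are subspaces.
\<close>

lemma rows_in_mono_imp_subset:
  assumes V: "\<forall>i\<in>{1..l}. linear_subspace l (V i)"
    and sub: "rows_in l V \<subseteq> rows_in l W" and i: "i \<in> {1..l}"
  shows "V i \<subseteq> W i"
proof
  have zero: "0\<^sub>v l \<in> V k" and car: "V k \<subseteq> carrier_vec l" if "k \<in> {1..l}" for k
    using V that by (auto simp: linear_subspace_def subspace_def submodule_def module_vec_simps)
  fix v assume v: "v \<in> V i"
  then have vc: "v \<in> carrier_vec l" using car i by blast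
  define A where "A = mat l l (\<lambda>(a, b). if a = i - 1 then v $ b else 0)"
  have row: "row_vector A k = (if k = i then v else 0\<^sub>v l)" if "k \<in> {1..l}" for k
    using that i vc by (intro eq_vecI) (auto simp: row_vector_def A_def)
  have "A \<in> rows_in l V" using row zero v by (auto simp: rows_in_def A_def)
  then have "row_vector A i \<in> W i" using sub i by (auto simp: rows_in_def)
  then show "v \<in> W i" using row[OF i] by simp
qed

lemma rows_in_determines_subspaces:
  assumes "\<forall>i\<in>{1..l}. linear_subspace l (V i)" "\<forall>i\<in>{1..l}. linear_subspace l (W i)"
    and "rows_in l V = rows_in l W" "i \<in> {1..l}"
  shows "V i = W i"
  using assms rows_in_mono_imp_subset[of l V W i] rows_in_mono_imp_subset[of l W V i] by blast

text \<open>
  Each hyperplane restricts one row only, so the conditions of an intersection can be collected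
  row by row.
\<close>

lemma hyperplane_inter_eq_rows_in:
  fixes X :: "nat \<Rightarrow> 'k::field mat set"
  assumes m: "m = l - 2 * g" "1 \<le> m" and X: "X ` I \<subseteq> hyperplanes l g"
  shows "hyperplane_inter l X I =
    rows_in l (\<lambda>i. dual_bases.common_kernel l (adapted_form m) (imposed_forms l m (X ` I) i))"
proof -
  interpret dual_bases l "adapted_basis l m" "adapted_form m :: nat \<Rightarrow> 'k vec \<Rightarrow> 'k"
    by (rule dual_bases_adapted) (use m in auto)
  have row_car: "row_vector A i \<in> carrier_vec l" if "A \<in> carrier_mat l l" for A :: "'k mat" and i
    using that by (auto simp: row_vector_def)
  have rowwise: "(\<forall>k\<in>I. A \<in> X k) \<longleftrightarrow>
      (\<forall>i\<in>{1..l}. \<forall>j\<in>imposed_forms l m (X ` I) i. adapted_form m j (row_vector A i) = 0)"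
    (is "?L \<longleftrightarrow> ?R") if A: "A \<in> carrier_mat l l" for A :: "'k mat"
  proof
    assume ?L
    then show ?R by (fastforce simp: imposed_forms_def form_hyperplane_def)
  next
    assume R: ?R
    show ?L
    proof
      fix k assume k: "k \<in> I"
      then obtain i j where ij: "X k = form_hyperplane l m i j" "i \<in> {1..m}" "j \<in> insert 1 {i<..m}"
        using X unfolding hyperplanes_eq_form_hyperplanes m(1)[symmetric] by blast
      then have "j \<in> imposed_forms l m (X ` I) i" "i \<in> {1..l}"
        using k m unfolding imposed_forms_def by (auto simp flip: ij(1))
      then show "A \<in> X k" using R A ij(1) by (auto simp: form_hyperplane_def)
    qed
  qed
  show ?thesis
  proof (rule Set.set_eqI)
    fix A :: "'k mat"
    have "A \<in> hyperplane_inter l X I \<longleftrightarrow> A \<in> carrier_mat l l \<and> (\<forall>k\<in>I. A \<in> X k)"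
      by (simp add: hyperplane_inter_def)
    also have "\<dots> \<longleftrightarrow> A \<in> rows_in l (\<lambda>i. common_kernel (imposed_forms l m (X ` I) i))"
      using rowwise row_car by (simp add: rows_in_def common_kernel_def cong: conj_cong)
    finally show "A \<in> hyperplane_inter l X I \<longleftrightarrow>
        A \<in> rows_in l (\<lambda>i. common_kernel (imposed_forms l m (X ` I) i))" .
  qed
qed

theorem lemma5p5:
  fixes l g N :: nat
    and X :: "nat \<Rightarrow> 'k::field mat set"
  assumes "l \<ge> 1"
    and "l - 2 * g \<ge> 1"
    and "N = (l - 2 * g + 1) choose 2"
    and "bij_betw X {1..N} (hyperplanes l g)"
  shows "\<forall>I \<subseteq> {1..N}. \<exists>V :: nat \<Rightarrow> 'k vec set.
    subspaces_cut_out l X I V \<and>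
    (\<forall>W. subspaces_cut_out l X I W \<longrightarrow> (\<forall>i\<in>{1..l}. W i = V i)) \<and>
    (\<forall>i\<in>{1..l}. subspace_dim l (V i) \<ge> i - 1) \<and>
    (\<exists>e :: nat \<Rightarrow> 'k vec. is_basis l e \<and>
      (\<forall>i\<in>{1..l}. \<exists>J \<subseteq> {1..l}. card J \<ge> i - 1 \<and> V i = linear_span l (e ` J)))"
proof (intro allI impI)
  fix I assume I: "I \<subseteq> {1..N}"
  define m where "m = l - 2 * g"
  have m: "1 \<le> m" "m \<le> l" using assms(2) by (auto simp: m_def)
  interpret dual_bases l "adapted_basis l m" "adapted_form m :: nat \<Rightarrow> 'k vec \<Rightarrow> 'k"
    by (rule dual_bases_adapted[OF m])
  define K where "K = imposed_forms l m (X ` I)"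
  define V where "V i = common_kernel (K i)" for i
  have K: "K i \<subseteq> {1..l}" for i unfolding K_def by (rule imposed_forms_subset[OF m(2)])
  have cardK: "i - 1 \<le> l - card (K i)" if "i \<in> {1..l}" for i
    using card_imposed_forms[OF m(2) that, of "X ` I"] that by (auto simp: K_def)
  have "X ` I \<subseteq> hyperplanes l g" using assms(4) I by (auto simp: bij_betw_def)
  then have inter: "hyperplane_inter l X I = rows_in l V"
    using hyperplane_inter_eq_rows_in[OF m_def m(1)] by (simp add: V_def[abs_def] K_def)
  have sub: "\<forall>i\<in>{1..l}. linear_subspace l (V i)"
    using common_kernel_subspace[OF K] by (simp add: V_def)
  show "\<exists>V. subspaces_cut_out l X I V \<and>
    (\<forall>W. subspaces_cut_out l X I W \<longrightarrow> (\<forall>i\<in>{1..l}. W i = V i)) \<and>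
    (\<forall>i\<in>{1..l}. subspace_dim l (V i) \<ge> i - 1) \<and>
    (\<exists>e :: nat \<Rightarrow> 'k vec. is_basis l e \<and>
      (\<forall>i\<in>{1..l}. \<exists>J \<subseteq> {1..l}. card J \<ge> i - 1 \<and> V i = linear_span l (e ` J)))"
  proof (rule exI[of _ V], intro conjI)
    show "subspaces_cut_out l X I V" using inter sub by (simp add: subspaces_cut_out_def)
    show "\<forall>W. subspaces_cut_out l X I W \<longrightarrow> (\<forall>i\<in>{1..l}. W i = V i)"
    proof (intro allI impI ballI)
      fix W i assume W: "subspaces_cut_out l X I W" and i: "i \<in> {1..l}"
      have "\<forall>i\<in>{1..l}. linear_subspace l (W i)" "rows_in l W = rows_in l V"
        using W inter by (simp_all add: subspaces_cut_out_def)
      then show "W i = V i" using rows_in_determines_subspaces sub i by blast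
    qed
    show "\<forall>i\<in>{1..l}. subspace_dim l (V i) \<ge> i - 1"
      using cardK dim_common_kernel[OF K] by (simp add: subspace_dim_def V_def)
    have "is_basis l (adapted_basis l m :: nat \<Rightarrow> 'k vec)"
      unfolding is_basis_def using inj_on_basis_vectors basis_vectors_basis by blast
    moreover have "\<exists>J \<subseteq> {1..l}. card J \<ge> i - 1 \<and> V i = linear_span l (adapted_basis l m ` J)"
      if i: "i \<in> {1..l}" for i
    proof (intro exI[of _ "{1..l} - K i"] conjI)
      show "card ({1..l} - K i) \<ge> i - 1"
        using cardK[OF i] K[of i] by (simp add: card_Diff_subset finite_subset)
      show "V i = linear_span l (adapted_basis l m ` ({1..l} - K i))"
        by (simp add: V_def linear_span_def common_kernel_eq_span[OF K])
    qed auto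
    ultimately show "\<exists>e :: nat \<Rightarrow> 'k vec. is_basis l e \<and>
      (\<forall>i\<in>{1..l}. \<exists>J \<subseteq> {1..l}. card J \<ge> i - 1 \<and> V i = linear_span l (e ` J))"
      by blast
  qed
qed

end
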